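(* Let $s\in\mathbb{Z}_{\ge1}$. Let $g(u)$ and $\mathcal{T}_1(u),\dots,\mathcal{T}_s(u)$ be functions of $u$, and extend to a family $\{\mathcal{T}_a(u)\}_{a\in\mathbb{Z}}$ by $\mathcal{T}_0(u)=g(u)$, $\mathcal{T}_a(u)=0$ for $a<0$, and the duality relation $\mathcal{T}_a(u)=\mathcal{T}_{2s+1-a}(u)$ (so $\mathcal{T}_a(u)=0$ for $a>2s+1$). For $m\in\mathbb{Z}_{\ge1}$ put $$T_m^{(a)}(u)=\det_{1\le i,j\le m}\big(\mathcal{T}_{a+i-j}(u+m-i-j+1)\big)\quad\text{for }a\in\{1,\dots,s-1\},$$ $$T_{2m}^{(s)}(u)=\det_{1\le i,j\le m}\big(\mathcal{T}_{s+i-j}(u+m-i-j+1)\big)$$ (so that $\mathcal{T}_a=T_1^{(a)}$ for $1\le a\le s-1$ and $\mathcal{T}_s=T_2^{(s)}$), and $T_0^{(a)}(u)=T_0^{(s)}(u)=T_m^{(0)}(u)=1$. Put $g_m^{(a)}(u)=\big\{\prod_{j=1}^m g(u+2j-m-1)\big\}^{\delta_{a,1}}$ if $s\ge2$ (so $g=g_1^{(1)}$ and $g_{2m}^{(s)}(u)=1$), and $g_{2m}^{(1)}(u)=\prod_{j=1}^m g(u+2j-m-1)$ if $s=1$ (so $g=g_2^{(1)}$). Then for all $m\in\mathbb{Z}_{\ge1}$ the following relations hold (the first being present only for $s\ge3$, the second only for $s\ge2$): $$T_m^{(a)}(u-1)T_m^{(a)}(u+1)=T_{m-1}^{(a)}(u)T_{m+1}^{(a)}(u)+g_m^{(a)}(u)T_m^{(a-1)}(u)T_m^{(a+1)}(u)\quad(1\le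 a\le s-2),$$ $$T_m^{(s-1)}(u-1)T_m^{(s-1)}(u+1)=T_{m-1}^{(s-1)}(u)T_{m+1}^{(s-1)}(u)+g_m^{(s-1)}(u)T_m^{(s-2)}(u)T_{2m}^{(s)}(u),$$ $$T_{2m}^{(s)}(u-1)T_{2m}^{(s)}(u+1)=T_{2m-2}^{(s)}(u)T_{2m+2}^{(s)}(u)+g_{2m}^{(s)}(u)T_m^{(s-1)}(u)T_{2m}^{(s)}(u).$$
   Context: All functions are complex-valued functions of the complex variable $u$ (e.g. meromorphic). $\delta_{a,1}$ is the Kronecker delta; in $T_n^{(s)}$ only even subscripts $n$ occur. For $s=1$ the only unknown is $T_{2m}^{(1)}$ and only the third relation is present, with $T_m^{(0)}=1$. *)

theory Defs
  imports Complex_Main "Jordan_Normal_Form.Determinant"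
begin

text \<open>The data \<open>g\<close> and \<open>t 1, \<dots>, t s\<close> are unconstrained: they extend to a family over all
  integer indices satisfying the vanishing and duality conditions in exactly one way.\<close>

lemma extension_exists_unique:
  fixes s :: nat and g :: "complex \<Rightarrow> complex" and t :: "int \<Rightarrow> complex \<Rightarrow> complex"
  shows "\<exists>!\<tau>. \<tau> 0 = g \<and> (\<forall>a\<in>{1..int s}. \<tau> a = t a) \<and>
    (\<forall>a<0. \<tau> a = (\<lambda>u. 0)) \<and> (\<forall>a. \<tau> a = \<tau> (2 * int s + 1 - a))"
proof (rule ex1I)
  let ?h = "\<lambda>a. if a < 0 then (\<lambda>u. 0) else if a = 0 then g else t a"
  let ?\<tau> = "\<lambda>a. ?h (min a (2 * int s + 1 - a))"
  show "?\<tau> 0 = g \<and> (\<forall>a\<in>{1..int s}. ?\<tau> a = t a) \<and>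
    (\<forall>a<0. ?\<tau> a = (\<lambda>u. 0)) \<and> (\<forall>a. ?\<tau> a = ?\<tau> (2 * int s + 1 - a))"
    by (auto simp: min_def)
  fix \<tau> :: "int \<Rightarrow> complex \<Rightarrow> complex"
  assume \<tau>: "\<tau> 0 = g \<and> (\<forall>a\<in>{1..int s}. \<tau> a = t a) \<and>
    (\<forall>a<0. \<tau> a = (\<lambda>u. 0)) \<and> (\<forall>a. \<tau> a = \<tau> (2 * int s + 1 - a))"
  have low: "\<tau> a = ?h a" if "a \<le> int s" for a
    using \<tau> that by auto
  show "\<tau> = ?\<tau>"
  proof
    fix a
    show "\<tau> a = ?\<tau> a"
    proof (cases "a \<le> int s")
      case True
      then have "min a (2 * int s + 1 - a) = a" by simp
      with low[OF True] show ?thesis by simp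
    next
      case False
      then have m: "min a (2 * int s + 1 - a) = 2 * int s + 1 - a"
        and le: "2 * int s + 1 - a \<le> int s" by simp_all
      have "\<tau> a = \<tau> (2 * int s + 1 - a)" using \<tau> by blast
      with low[OF le] m show ?thesis by simp
    qed
  qed
qed

text \<open>Matrix indices in \<^const>\<open>mat\<close> start at 0, whence the shifts by 1 below.\<close>

definition det_block :: "(int \<Rightarrow> complex \<Rightarrow> complex) \<Rightarrow> int \<Rightarrow> nat \<Rightarrow> complex \<Rightarrow> complex" where
  "det_block \<tau> a m u = det (mat m m (\<lambda>(i, j).
     \<tau> (a + int (i + 1) - int (j + 1))
       (u + of_nat m - of_nat (i + 1) - of_nat (j + 1) + 1)))"

text \<open>\<open>T_fun s \<tau> a n u\<close> is $T_n^{(a)}(u)$ for \<open>a < s\<close>; for \<open>a = s\<close> it is meaningful for even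
  \<open>n\<close> only, $T_{2m}^{(s)}$ being a determinant of size \<open>m\<close>. Values with \<open>a > s\<close>, or with \<open>a = s\<close>
  and odd \<open>n\<close>, are irrelevant.\<close>

definition T_fun :: "nat \<Rightarrow> (int \<Rightarrow> complex \<Rightarrow> complex) \<Rightarrow> nat \<Rightarrow> nat \<Rightarrow> complex \<Rightarrow> complex" where
  "T_fun s \<tau> a n u =
     (if n = 0 \<or> a = 0 then 1
      else if a = s then det_block \<tau> (int s) (n div 2) u
      else det_block \<tau> (int a) n u)"

definition g_prod :: "(complex \<Rightarrow> complex) \<Rightarrow> nat \<Rightarrow> complex \<Rightarrow> complex" where
  "g_prod g m u = (\<Prod>j = 1..m. g (u + 2 * of_nat j - of_nat m - 1))"

text \<open>\<open>g_fun s g a n u\<close> is $g_n^{(a)}(u)$; the exponent is the Kronecker delta $\delta_{a,1}$. For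
  \<open>s = 1\<close> only $g_{2m}^{(1)}$ occurs, which is a product of \<open>m\<close> factors.\<close>

definition g_fun :: "nat \<Rightarrow> (complex \<Rightarrow> complex) \<Rightarrow> nat \<Rightarrow> nat \<Rightarrow> complex \<Rightarrow> complex" where
  "g_fun s g a n u =
     (if s \<ge> 2 then g_prod g n u ^ (if a = 1 then 1 else 0)
      else g_prod g (n div 2) u)"

end

theory Submission
  imports Defs "Jordan_Normal_Form.Char_Poly"
begin

text \<open>
  Deleting border rows and columns from the determinant $T_{m+1}^{(a)}(u)$ only shifts $u$, $m$
  and $a$, so all relations are instances of the Desnanot--Jacobi identity. At the boundaries,
  the determinant for $a = 0$ is lower triangular and gives the product of values of $g$, and
  the duality relation turns the determinant for $a = s + 1$ into the transpose of the one for
  $a = s$.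
\<close>

section \<open>Determinant expansions and the Desnanot-Jacobi identity\<close>

lemma det_column_single:
  fixes A :: "'a :: comm_ring_1 mat"
  assumes "A \<in> carrier_mat n n" "i < n" "j < n"
    and "\<And>k. k < n \<Longrightarrow> k \<noteq> i \<Longrightarrow> A $$ (k, j) = 0"
  shows "det A = A $$ (i, j) * cofactor A i j"
proof -
  have "det A = (\<Sum>k<n. A $$ (k, j) * cofactor A k j)"
    using laplace_expansion_column assms by blast
  also have "\<dots> = (\<Sum>k\<in>{i}. A $$ (k, j) * cofactor A k j)"
    by (rule sum.mono_neutral_right) (use assms in auto)
  finally show ?thesis by simp
qed

lemma det_row_single:
  fixes A :: "'a :: comm_ring_1 mat"
  assumes "A \<in> carrier_mat n n" "i < n" "j < n"
    and "\<And>k. k < n \<Longrightarrow> k \<noteq> j \<Longrightarrow> A $$ (i, k) = 0"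
  shows "det A = A $$ (i, j) * cofactor A i j"
proof -
  have "det A = (\<Sum>k<n. A $$ (i, k) * cofactor A i k)"
    using laplace_expansion_row assms by blast
  also have "\<dots> = (\<Sum>k\<in>{j}. A $$ (i, k) * cofactor A i k)"
    by (rule sum.mono_neutral_right) (use assms in auto)
  finally show ?thesis by simp
qed

text \<open>Row 0 meets only the two replaced columns of the identity matrix, so the expansion has
  two terms. In each remaining minor the last row has a single nonzero entry whose complement is an
  identity matrix.\<close>

lemma det_border_columns:
  fixes c d :: "nat \<Rightarrow> 'a :: comm_ring_1"
  shows "det (mat (k + 2) (k + 2) (\<lambda>(i, j).
      if j = 0 then c i else if j = k + 1 then d i else if i = j then 1 else 0)) =
    c 0 * d (k + 1) - d 0 * c (k + 1)" (is "det ?B = _")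
proof -
  let ?L = "mat_delete ?B 0 0" and ?R = "mat_delete ?B 0 (k + 1)"
  have "det ?B = (\<Sum>j<k + 2. ?B $$ (0, j) * cofactor ?B 0 j)"
    by (rule laplace_expansion_row) auto
  also have "\<dots> = (\<Sum>j\<in>{0, k + 1}. ?B $$ (0, j) * cofactor ?B 0 j)"
    by (rule sum.mono_neutral_right) auto
  also have "\<dots> = c 0 * det ?L + (- 1) ^ (k + 1) * d 0 * det ?R"
    by (simp add: cofactor_def)
  also have "det ?L = d (k + 1)"
  proof -
    have "det ?L = ?L $$ (k, k) * cofactor ?L k k"
      by (rule det_row_single[of _ "k + 1"]) (auto simp: mat_delete_def)
    also have "mat_delete ?L k k = 1\<^sub>m k"
      by (rule eq_matI) (auto simp: mat_delete_def)
    then have "?L $$ (k, k) * cofactor ?L k k = d (k + 1)"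
      by (simp add: cofactor_def) (simp add: mat_delete_def)
    finally show ?thesis .
  qed
  also have "det ?R = (- 1) ^ k * c (k + 1)"
  proof -
    have "det ?R = ?R $$ (k, 0) * cofactor ?R k 0"
      by (rule det_row_single[of _ "k + 1"]) (auto simp: mat_delete_def)
    also have "mat_delete ?R k 0 = 1\<^sub>m k"
      by (rule eq_matI) (auto simp: mat_delete_def)
    then have "?R $$ (k, 0) * cofactor ?R k 0 = (- 1) ^ k * c (k + 1)"
      by (simp add: cofactor_def) (simp add: mat_delete_def)
    finally show ?thesis .
  qed
  finally show ?thesis
    by (simp add: algebra_simps flip: power_add mult_2)
qed

text \<open>Let \<open>B\<close> be the identity matrix with its outer columns replaced by those of
  the adjugate of \<open>A\<close>. In \<open>A * B\<close> these become \<open>det A\<close> times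
  unit vectors, so \<open>det A * det B\<close> is \<open>det A\<close> squared times the inner
  minor. Cancelling \<open>det A\<close> gives the identity, since \<open>det B\<close> is a 2 by 2
  minor of the adjugate.\<close>

lemma desnanot_jacobi_nonsingular:
  fixes A :: "'a :: idom mat"
  assumes A: "A \<in> carrier_mat (k + 2) (k + 2)" and nz: "det A \<noteq> 0"
  shows "det A * det (mat_delete (mat_delete A 0 0) k k) =
    det (mat_delete A 0 0) * det (mat_delete A (k + 1) (k + 1))
    - det (mat_delete A 0 (k + 1)) * det (mat_delete A (k + 1) 0)"
proof -
  let ?n = "k + 2"
  define c d where "c i = cofactor A 0 i" and "d i = cofactor A (k + 1) i" for i
  define B where "B = mat ?n ?n (\<lambda>(i, j).
      if j = 0 then c i else if j = k + 1 then d i else if i = j then 1 else 0)"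
  define C where "C = mat ?n ?n (\<lambda>(i, j).
      if j = 0 \<or> j = k + 1 then (if i = j then det A else 0) else A $$ (i, j))"
  have adj: "(\<Sum>l<?n. A $$ (i, l) * cofactor A j l) = (if i = j then det A else 0)"
    if "i < ?n" "j < ?n" for i j
  proof -
    have "(A * adj_mat A) $$ (i, j) = (\<Sum>l<?n. A $$ (i, l) * cofactor A j l)"
      using that A by (simp add: adj_mat_def scalar_prod_def lessThan_atLeast0)
    with adj_mat(2)[OF A] that show ?thesis by (cases "i = j") simp_all
  qed
  have "A * B = C"
  proof (rule eq_matI)
    fix i j assume ij: "i < dim_row C" "j < dim_col C"
    then have ij': "i < ?n" "j < ?n" by (auto simp: C_def)
    have "(A * B) $$ (i, j) = (\<Sum>l<?n. A $$ (i, l) * B $$ (l, j))"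
      using A ij' by (simp add: B_def scalar_prod_def lessThan_atLeast0)
    also have "\<dots> = C $$ (i, j)"
    proof (cases "j = 0 \<or> j = k + 1")
      case True
      then have "(\<Sum>l<?n. A $$ (i, l) * B $$ (l, j)) = (\<Sum>l<?n. A $$ (i, l) * cofactor A j l)"
        by (intro sum.cong) (auto simp: B_def c_def d_def)
      with adj[OF ij'] True ij' show ?thesis by (simp add: C_def)
    next
      case False
      then have "(\<Sum>l<?n. A $$ (i, l) * B $$ (l, j)) = (\<Sum>l<?n. if l = j then A $$ (i, l) else 0)"
        using ij' by (intro sum.cong) (auto simp: B_def)
      with False ij' show ?thesis by (simp add: C_def)
    qed
    finally show "(A * B) $$ (i, j) = C $$ (i, j)" .
  qed (use A in \<open>auto simp: B_def C_def\<close>)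
  then have "det A * det B = det C"
    using det_mult[OF A, of B] by (simp add: B_def)
  also have "det C = det A * det (mat_delete C 0 0)"
    by (subst det_column_single[of _ ?n 0 0]) (auto simp: C_def cofactor_def)
  \<comment> \<open>With row and column 0 gone, the last column has index \<open>k\<close>, and its
    only nonzero entry is \<open>det A\<close> on the diagonal.\<close>
  also have "det (mat_delete C 0 0) = det A * det (mat_delete (mat_delete C 0 0) k k)"
    by (subst det_column_single[of _ "k + 1" k k])
      (auto simp: C_def cofactor_def mat_delete_def)
  also have "mat_delete (mat_delete C 0 0) k k = mat_delete (mat_delete A 0 0) k k"
    by (rule eq_matI) (use A in \<open>auto simp: C_def mat_delete_def\<close>)
  finally have "det B = det A * det (mat_delete (mat_delete A 0 0) k k)"
    using nz by simp
  moreover have "det B = c 0 * d (k + 1) - d 0 * c (k + 1)"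
    unfolding B_def by (rule det_border_columns)
  \<comment> \<open>The cofactor signs cancel: the diagonal corners carry even powers of -1, and the
    two off-diagonal corners carry \<open>(- 1) ^ (k + 1)\<close> each.\<close>
  ultimately show ?thesis
    by (simp add: c_def d_def cofactor_def algebra_simps flip: power_add mult_2)
qed

text \<open>The characteristic matrix of \<open>- A\<close> is nonsingular and specialises to \<open>A\<close> at \<open>0\<close>.\<close>

lemma desnanot_jacobi:
  fixes A :: "'a :: idom mat"
  assumes A: "A \<in> carrier_mat (k + 2) (k + 2)"
  shows "det A * det (mat_delete (mat_delete A 0 0) k k) =
    det (mat_delete A 0 0) * det (mat_delete A (k + 1) (k + 1))
    - det (mat_delete A 0 (k + 1)) * det (mat_delete A (k + 1) 0)"
proof -
  define P where "P = char_poly_matrix (- A)"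
  have P: "P \<in> carrier_mat (k + 2) (k + 2)" using A by (simp add: P_def)
  have entry: "poly (P $$ (i, j)) 0 = A $$ (i, j)" if "i < k + 2" "j < k + 2" for i j
    using A that by (simp add: P_def char_poly_matrix_def)
  have "det P = char_poly (- A)" by (simp add: P_def char_poly_def)
  moreover have "coeff (char_poly (- A)) (k + 2) = 1"
    using degree_monic_char_poly[of "- A" "k + 2"] A by simp
  ultimately have "det P \<noteq> 0" by auto
  \<comment> \<open>Polynomials over an integral domain again form one, so the nonsingular case
    applies to \<open>P\<close>; evaluation at 0 is a ring homomorphism and hence commutes with
    determinants.\<close>
  from arg_cong[OF desnanot_jacobi_nonsingular[OF P this], of "\<lambda>p. poly p 0"]
  have "poly (det P) 0 * poly (det (mat_delete (mat_delete P 0 0) k k)) 0 =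
    poly (det (mat_delete P 0 0)) 0 * poly (det (mat_delete P (k + 1) (k + 1))) 0
    - poly (det (mat_delete P 0 (k + 1))) 0 * poly (det (mat_delete P (k + 1) 0)) 0"
    by simp
  moreover have "poly (det P) 0 = det A"
    by (rule poly_det_cong[OF A P]) (rule entry)
  moreover have "poly (det (mat_delete P i j)) 0 = det (mat_delete A i j)" for i j
    by (rule poly_det_cong[of _ "k + 1"]) (use A P in \<open>auto simp: mat_delete_def entry\<close>)
  moreover have "poly (det (mat_delete (mat_delete P 0 0) k k)) 0 =
      det (mat_delete (mat_delete A 0 0) k k)"
    by (rule poly_det_cong[of _ k]) (use A P in \<open>auto simp: mat_delete_def entry\<close>)
  ultimately show ?thesis by simp
qed

section \<open>Relations between the determinants and their boundary values\<close>

lemma det_block_0: "det_block \<tau> a 0 u = 1"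
  by (simp add: det_block_def)

text \<open>This is the common form of all three relations, for an arbitrary integer
  \<open>a\<close>; boundary conditions on \<open>\<tau>\<close> enter only afterwards, through the
  neighbours \<open>a - 1\<close> and \<open>a + 1\<close>.\<close>

lemma det_block_relation:
  assumes "m \<ge> 1"
  shows "det_block \<tau> a m (u - 1) * det_block \<tau> a m (u + 1) =
    det_block \<tau> a (m - 1) u * det_block \<tau> a (m + 1) u
    + det_block \<tau> (a - 1) m u * det_block \<tau> (a + 1) m u"
proof -
  from assms obtain k where m: "m = k + 1" using le_Suc_ex by (metis add.commute)
  define A where "A = mat (k + 2) (k + 2) (\<lambda>(i, j). \<tau> (a + int (i + 1) - int (j + 1))
    (u + of_nat (k + 2) - of_nat (i + 1) - of_nat (j + 1) + 1))"
  have "det A = det_block \<tau> a (m + 1) u"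
    by (simp add: A_def det_block_def m)
  moreover have "det (mat_delete (mat_delete A 0 0) k k) = det_block \<tau> a (m - 1) u"
    unfolding det_block_def A_def m
    by (rule arg_cong[where f = det], rule eq_matI) (auto simp: mat_delete_def algebra_simps)
  \<comment> \<open>Dropping the first row and column keeps the difference \<open>i - j\<close> and
    raises \<open>i + j\<close> by 2; as the size also falls by 1, the net effect is to shift
    \<open>u\<close> by -1.\<close>
  moreover have "det (mat_delete A 0 0) = det_block \<tau> a m (u - 1)"
    unfolding det_block_def A_def m
    by (rule arg_cong[where f = det], rule eq_matI) (auto simp: mat_delete_def algebra_simps)
  moreover have "det (mat_delete A (k + 1) (k + 1)) = det_block \<tau> a m (u + 1)"
    unfolding det_block_def A_def m
    by (rule arg_cong[where f = det], rule eq_matI) (auto simp: mat_delete_def algebra_simps)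
  \<comment> \<open>Here only the row index moves: the difference \<open>i - j\<close> grows by 1,
    and the change of \<open>i + j\<close> is absorbed by the smaller size, so \<open>u\<close>
    stays.\<close>
  moreover have "det (mat_delete A 0 (k + 1)) = det_block \<tau> (a + 1) m u"
    unfolding det_block_def A_def m
    by (rule arg_cong[where f = det], rule eq_matI) (auto simp: mat_delete_def algebra_simps)
  moreover have "det (mat_delete A (k + 1) 0) = det_block \<tau> (a - 1) m u"
    unfolding det_block_def A_def m
    by (rule arg_cong[where f = det], rule eq_matI) (auto simp: mat_delete_def algebra_simps)
  moreover have "A \<in> carrier_mat (k + 2) (k + 2)" by (simp add: A_def)
  ultimately show ?thesis using desnanot_jacobi[of A k] by (simp add: algebra_simps)
qed

lemma det_block_zero_index:
  assumes "\<And>u. \<tau> 0 u = g u" and "\<And>a u. a < 0 \<Longrightarrow> \<tau> a u = 0"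
  shows "det_block \<tau> 0 m u = g_prod g m u"
proof -
  have "det_block \<tau> 0 m u = (\<Prod>i<m. g (u + of_nat m - of_nat (i + 1) - of_nat (i + 1) + 1))"
    unfolding det_block_def
    by (subst det_lower_triangular[of m])
      (auto simp: assms prod_list_diag_prod lessThan_atLeast0 intro!: prod.cong)
  also have "\<dots> = g_prod g m u"
    unfolding g_prod_def
    \<comment> \<open>The arguments of \<open>g\<close> decrease down the diagonal but increase in
      \<open>g_prod\<close>, so the order is reversed.\<close>
    by (rule prod.reindex_bij_witness[of _ "\<lambda>j. m - j" "\<lambda>i. m - i"])
      (auto simp: of_nat_diff algebra_simps)
  finally show ?thesis .
qed

lemma det_block_dual:
  assumes "\<And>a u. \<tau> a u = \<tau> (2 * int s + 1 - a) u"
  shows "det_block \<tau> (int s + 1) m u = det_block \<tau> (int s) m u"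
proof -
  let ?M = "\<lambda>a. mat m m (\<lambda>(i, j). \<tau> (a + int (i + 1) - int (j + 1))
    (u + of_nat m - of_nat (i + 1) - of_nat (j + 1) + 1))"
  have "?M (int s + 1) = transpose_mat (?M (int s))"
  proof (rule eq_matI)
    fix i j assume "i < dim_row (transpose_mat (?M (int s)))" "j < dim_col (transpose_mat (?M (int s)))"
    then show "?M (int s + 1) $$ (i, j) = transpose_mat (?M (int s)) $$ (i, j)"
      \<comment> \<open>Duality sends the subscript \<open>s + 1 + i - j\<close> to
        \<open>s + j - i\<close>, while the argument is symmetric in \<open>i\<close> and
        \<open>j\<close>.\<close>
      using assms[of "int s + 1 + int i - int j"] by (simp add: algebra_simps)
  qed auto
  then show ?thesis
    unfolding det_block_def by (simp only: det_transpose[of _ m] mat_carrier)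
qed

section \<open>The three relations\<close>

theorem theorem4p2:
  fixes s :: nat
    and g :: "complex \<Rightarrow> complex"
    and \<tau> :: "int \<Rightarrow> complex \<Rightarrow> complex"
  assumes s: "s \<ge> 1"
    and zero: "\<And>u. \<tau> 0 u = g u"
    and neg: "\<And>a u. a < 0 \<Longrightarrow> \<tau> a u = 0"
    and duality: "\<And>a u. \<tau> a u = \<tau> (2 * int s + 1 - a) u"
  shows "\<forall>m\<ge>1. \<forall>u.
    (\<forall>a. 1 \<le> a \<and> a + 2 \<le> s \<longrightarrow>
       T_fun s \<tau> a m (u - 1) * T_fun s \<tau> a m (u + 1) =
         T_fun s \<tau> a (m - 1) u * T_fun s \<tau> a (m + 1) u
         + g_fun s g a m u * T_fun s \<tau> (a - 1) m u * T_fun s \<tau> (a + 1) m u) \<and>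
    (s \<ge> 2 \<longrightarrow>
       T_fun s \<tau> (s - 1) m (u - 1) * T_fun s \<tau> (s - 1) m (u + 1) =
         T_fun s \<tau> (s - 1) (m - 1) u * T_fun s \<tau> (s - 1) (m + 1) u
         + g_fun s g (s - 1) m u * T_fun s \<tau> (s - 2) m u * T_fun s \<tau> s (2 * m) u) \<and>
    T_fun s \<tau> s (2 * m) (u - 1) * T_fun s \<tau> s (2 * m) (u + 1) =
      T_fun s \<tau> s (2 * m - 2) u * T_fun s \<tau> s (2 * m + 2) u
      + g_fun s g s (2 * m) u * T_fun s \<tau> (s - 1) m u * T_fun s \<tau> s (2 * m) u"
proof (intro allI impI)
  fix m :: nat and u :: complex
  assume m: "m \<ge> 1"
  \<comment> \<open>The case \<open>n = 0\<close> is covered, because the empty determinant is 1;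
    this matters for \<open>m - 1\<close> when \<open>m = 1\<close>.\<close>
  have low: "T_fun s \<tau> a n v = det_block \<tau> (int a) n v" if "1 \<le> a" "a < s" for a n v
    using that by (simp add: T_fun_def det_block_0)
  have top: "T_fun s \<tau> s (2 * n) v = det_block \<tau> (int s) n v" for n v
    using s by (simp add: T_fun_def det_block_0)
  \<comment> \<open>For \<open>a = 1\<close> the convention value of \<open>T_fun\<close> is 1 and
    the factor \<open>g_fun\<close> supplies the triangular determinant; for larger \<open>a\<close>
    the roles swap, since the Kronecker exponent makes \<open>g_fun\<close> equal to 1.\<close>
  have bottom: "g_fun s g a m u * T_fun s \<tau> (a - 1) m u = det_block \<tau> (int a - 1) m u"
    if "1 \<le> a" "a < s" for a
  proof (cases "a = 1")
    case True
    with that show ?thesis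
      by (simp add: g_fun_def T_fun_def det_block_zero_index[of \<tau> g, OF zero neg])
  next
    case False
    with that low[of "a - 1"] show ?thesis by (simp add: g_fun_def of_nat_diff)
  qed
  \<comment> \<open>The same at the top node. For \<open>s = 1\<close> the second branch of
    \<open>g_fun\<close> halves \<open>2 * m\<close>, which gives the \<open>m\<close> factors of
    the triangular determinant.\<close>
  have bottom_s: "g_fun s g s (2 * m) u * T_fun s \<tau> (s - 1) m u = det_block \<tau> (int s - 1) m u"
  proof (cases "s = 1")
    case True
    then show ?thesis
      by (simp add: g_fun_def T_fun_def det_block_zero_index[of \<tau> g, OF zero neg])
  next
    case False
    with s low[of "s - 1"] show ?thesis by (simp add: g_fun_def of_nat_diff)
  qed
  have "T_fun s \<tau> a m (u - 1) * T_fun s \<tau> a m (u + 1) =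
      T_fun s \<tau> a (m - 1) u * T_fun s \<tau> a (m + 1) u
      + g_fun s g a m u * T_fun s \<tau> (a - 1) m u * T_fun s \<tau> (a + 1) m u"
    if "1 \<le> a" "a + 2 \<le> s" for a
    using that det_block_relation[OF m, of \<tau> "int a" u] bottom[of a] low[of a] low[of "a + 1"]
    by (simp add: add.commute)
  moreover have "T_fun s \<tau> (s - 1) m (u - 1) * T_fun s \<tau> (s - 1) m (u + 1) =
      T_fun s \<tau> (s - 1) (m - 1) u * T_fun s \<tau> (s - 1) (m + 1) u
      + g_fun s g (s - 1) m u * T_fun s \<tau> (s - 2) m u * T_fun s \<tau> s (2 * m) u"
    if "s \<ge> 2"
    using that det_block_relation[OF m, of \<tau> "int (s - 1)" u] bottom[of "s - 1"] low[of "s - 1"]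
      top[of m]
    by (simp add: of_nat_diff numeral_2_eq_2)
  moreover have "T_fun s \<tau> s (2 * m) (u - 1) * T_fun s \<tau> s (2 * m) (u + 1) =
      T_fun s \<tau> s (2 * m - 2) u * T_fun s \<tau> s (2 * m + 2) u
      + g_fun s g s (2 * m) u * T_fun s \<tau> (s - 1) m u * T_fun s \<tau> s (2 * m) u"
  proof -
    \<comment> \<open>Even subscripts are put in the form matched by \<open>top\<close>; duality
      then turns the neighbour \<open>s + 1\<close> into \<open>s\<close>, whence the factor
      \<open>T_fun s \<tau> s (2 * m) u\<close> on the right.\<close>
    have "2 * m - 2 = 2 * (m - 1)" "2 * m + 2 = 2 * (m + 1)" by simp_all
    then show ?thesis
      using det_block_relation[OF m, of \<tau> "int s" u]
      by (simp only: top bottom_s det_block_dual[of \<tau> s, OF duality])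
  qed
  ultimately show "(\<forall>a. 1 \<le> a \<and> a + 2 \<le> s \<longrightarrow>
       T_fun s \<tau> a m (u - 1) * T_fun s \<tau> a m (u + 1) =
         T_fun s \<tau> a (m - 1) u * T_fun s \<tau> a (m + 1) u
         + g_fun s g a m u * T_fun s \<tau> (a - 1) m u * T_fun s \<tau> (a + 1) m u) \<and>
    (s \<ge> 2 \<longrightarrow>
       T_fun s \<tau> (s - 1) m (u - 1) * T_fun s \<tau> (s - 1) m (u + 1) =
         T_fun s \<tau> (s - 1) (m - 1) u * T_fun s \<tau> (s - 1) (m + 1) u
         + g_fun s g (s - 1) m u * T_fun s \<tau> (s - 2) m u * T_fun s \<tau> s (2 * m) u) \<and>
    T_fun s \<tau> s (2 * m) (u - 1) * T_fun s \<tau> s (2 * m) (u + 1) =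
      T_fun s \<tau> s (2 * m - 2) u * T_fun s \<tau> s (2 * m + 2) u
      + g_fun s g s (2 * m) u * T_fun s \<tau> (s - 1) m u * T_fun s \<tau> s (2 * m) u"
    by blast
qed

end
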